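(* Let $N\ge1$, let $\alpha_1,\dots,\alpha_N$ be rationally independent real numbers (linearly independent over $\mathbb{Q}$), and let $p_0>0$, $0<p_i<1$ for $i\in\{1,\dots,N\}$, with $\sum_{i=0}^Np_i=1$. Let $x_n=\sum_{j=1}^nu_j$, $x_0=0$, where $(u_j)_{j\ge1}$ are i.i.d. real random variables with law $p_0\delta_0+\frac12\sum_{i=1}^Np_i(\delta_{\alpha_i}+\delta_{-\alpha_i})$. Let $\gamma\in(0,\frac12)$ and let $(\delta_n)$ be a positive sequence such that $\delta_n\to0$ and $\delta_n\ge n^{-(\frac12-\gamma)}$. Then $$\mathbb{P}\big[x_{2n}\in(-\delta_n^{-1},\delta_n^{-1})\big]\sim_n2\,\delta_n^{-1}\,\frac{1}{\sqrt{2\pi(2n)}\,\sigma},\qquad\text{where }\sigma^2=\sum_{i=1}^Np_i\alpha_i^2 .$$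
   Context: $\delta_x$ (with $x$ one of $0,\pm\alpha_i$) denotes the Dirac mass at $x$, not to be confused with the sequence $(\delta_n)$. Here $\sigma>0$, and $\sim_n$ means that the ratio tends to $1$ as $n\to\infty$. *)

theory Defs
  imports "HOL-Probability.Probability" "HOL-Library.Landau_Symbols"
begin

text \<open>
  The scalar multiplication of the rational vector space of real numbers is passed explicitly to
  the library's linear independence of a set; injectivity makes it a statement about the family
  (see \<open>rationally_independent_iff\<close>).
\<close>

definition rationally_independent :: "'i set \<Rightarrow> ('i \<Rightarrow> real) \<Rightarrow> bool" where
  "rationally_independent I \<alpha> \<longleftrightarrow>
     inj_on \<alpha> I \<and> module.independent (\<lambda>(q::rat) (x::real). of_rat q * x) (\<alpha> ` I)"

lemma rationally_independent_iff:
  assumes "finite I"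
  shows "rationally_independent I \<alpha> \<longleftrightarrow>
    (\<forall>q::'i \<Rightarrow> rat. (\<Sum>i\<in>I. of_rat (q i) * \<alpha> i) = 0 \<longrightarrow> (\<forall>i\<in>I. q i = 0))"
proof -
  interpret Q: module "\<lambda>(q::rat) (x::real). of_rat q * x"
    by unfold_locales (auto simp: algebra_simps of_rat_add of_rat_mult)
  show ?thesis
  proof (intro iffI allI impI ballI)
    fix q :: "'i \<Rightarrow> rat" and i
    assume ind: "rationally_independent I \<alpha>" and s: "(\<Sum>i\<in>I. of_rat (q i) * \<alpha> i) = 0" and i: "i \<in> I"
    from ind have inj: "inj_on \<alpha> I" and li: "Q.independent (\<alpha> ` I)"
      by (auto simp: rationally_independent_def)
    have "(\<Sum>x\<in>\<alpha> ` I. of_rat (q (inv_into I \<alpha> x)) * x) = 0"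
      using s inj by (simp add: sum.reindex)
    with li assms i have "q (inv_into I \<alpha> (\<alpha> i)) = 0"
      using Q.independentD[of "\<alpha> ` I" "\<alpha> ` I" "\<lambda>x. q (inv_into I \<alpha> x)" "\<alpha> i"] by blast
    then show "q i = 0" using inj i by simp
  next
    assume *: "\<forall>q::'i \<Rightarrow> rat. (\<Sum>i\<in>I. of_rat (q i) * \<alpha> i) = 0 \<longrightarrow> (\<forall>i\<in>I. q i = 0)"
    have inj: "inj_on \<alpha> I"
    proof (rule inj_onI, rule ccontr)
      fix i j assume ij: "i \<in> I" "j \<in> I" "\<alpha> i = \<alpha> j" "i \<noteq> j"
      define q where "q k = (if k = i then 1 else if k = j then -1 else (0::rat))" for k
      have "(\<Sum>k\<in>I. of_rat (q k) * \<alpha> k) = (\<Sum>k\<in>{i,j}. of_rat (q k) * \<alpha> k)"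
        using ij assms by (intro sum.mono_neutral_right) (auto simp: q_def)
      also have "\<dots> = 0" using ij by (simp add: q_def of_rat_minus)
      finally have "q i = 0" using * ij by blast
      then show False by (simp add: q_def)
    qed
    have "Q.independent (\<alpha> ` I)"
      unfolding Q.dependent_finite[OF finite_imageI[OF assms]]
    proof safe
      fix u :: "real \<Rightarrow> rat" and i
      assume "i \<in> I" "u (\<alpha> i) \<noteq> 0" "(\<Sum>v\<in>\<alpha> ` I. of_rat (u v) * v) = 0"
      then show False using *[rule_format, of "\<lambda>i. u (\<alpha> i)" i] inj by (simp add: sum.reindex)
    qed
    with inj show "rationally_independent I \<alpha>" by (simp add: rationally_independent_def)
  qed
qed

definition step_law :: "nat \<Rightarrow> (nat \<Rightarrow> real) \<Rightarrow> (nat \<Rightarrow> real) \<Rightarrow> real measure" where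
  "step_law N p \<alpha> = measure_of UNIV (sets borel) (\<lambda>A.
     ennreal (p 0) * emeasure (return borel 0) A +
     ennreal (1 / 2) * (\<Sum>i=1..N. ennreal (p i) *
       (emeasure (return borel (\<alpha> i)) A + emeasure (return borel (- \<alpha> i)) A)))"

lemma space_step_law: "space (step_law N p \<alpha>) = UNIV"
  by (simp add: step_law_def)

lemma sets_step_law: "sets (step_law N p \<alpha>) = sets borel"
  by (simp add: step_law_def) (metis sets.sigma_sets_eq space_borel)

text \<open>
  The set function above is countably additive, so it really is the value of the measure
  (\<^const>\<open>measure_of\<close> would otherwise yield the zero measure).
\<close>

lemma emeasure_step_law:
  assumes A: "A \<in> sets borel"
  shows "emeasure (step_law N p \<alpha>) A =
     ennreal (p 0) * emeasure (return borel 0) A +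
     ennreal (1 / 2) * (\<Sum>i=1..N. ennreal (p i) *
       (emeasure (return borel (\<alpha> i)) A + emeasure (return borel (- \<alpha> i)) A))"
    (is "_ = ?\<mu> A")
proof (rule emeasure_measure_of[OF step_law_def])
  show "sets borel \<subseteq> Pow (UNIV :: real set)" by simp
  show "positive (sets (step_law N p \<alpha>)) ?\<mu>" by (simp add: positive_def)
  show "A \<in> sets (step_law N p \<alpha>)" using A by (simp add: sets_step_law)
  show "countably_additive (sets (step_law N p \<alpha>)) ?\<mu>"
  proof (rule countably_additiveI)
    fix B :: "nat \<Rightarrow> real set"
    assume "range B \<subseteq> sets (step_law N p \<alpha>)" "disjoint_family B"
    then have s: "(\<Sum>k. emeasure (return borel x) (B k)) = emeasure (return borel x) (\<Union>k. B k)" for x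
      by (intro suminf_emeasure) (auto simp: sets_step_law)
    show "(\<Sum>k. ?\<mu> (B k)) = ?\<mu> (\<Union>k. B k)"
      by (simp add: suminf_add[symmetric] suminf_sum ennreal_suminf_cmult s)
  qed
qed

definition walk :: "(nat \<Rightarrow> 'a \<Rightarrow> real) \<Rightarrow> nat \<Rightarrow> 'a \<Rightarrow> real" where
  "walk u n \<omega> = (\<Sum>j=1..n. u j \<omega>)"

end

theory Submission
  imports Defs
begin

text \<open>
  Write \<open>L = 1 / \<delta>\<close>, so that \<open>L\<close> tends to infinity while \<open>L = o(sqrt n)\<close>. On the scale of
  \<open>L\<close> the Gaussian density of the walk, whose own scale is \<open>\<sigma> * sqrt (2 n)\<close>, is flat, and the claim
  is that the walk at time \<open>2 n\<close> falls into the window \<open>(-L, L)\<close> with the probability that this flat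
  density predicts. The central limit theorem does not resolve such short windows.

  The window is tested first with the Fejer kernel \<open>2 (1 - cos x) / x\<^sup>2\<close> at scale \<open>L\<close>. It is the
  characteristic function of the triangular distribution, which lives on \<open>[-1, 1]\<close>; by Fubini
  (\<open>parseval_char\<close>) the expectation of the kernel, even when multiplied by a character, is an
  integral of the characteristic function \<open>\<phi> ^ (2 n)\<close> of the walk over frequencies \<open>O(1 / L)\<close> only.
  There the expansion \<open>\<phi> s = 1 - \<sigma>\<^sup>2 s\<^sup>2 / 2 + O(s ^ 4)\<close> of the characteristic function of
  one step gives a Gaussian limit and a Gaussian bound, and dominated convergence yields
  the asymptotics (\<open>tilted_char_asymptotics\<close>).

  To pass from the kernel to the indicator of the window, reweight the law of the walk, rescaled by
  \<open>L\<close>, with the kernel and normalise it to a probability measure. The asymptotics state that the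
  characteristic functions of these measures converge to the triangle, which is the characteristic
  function of the probability density \<open>fejer / (2 pi)\<close> (\<open>fourier_fejer\<close>). Levy's continuity theorem
  gives weak convergence, and since the kernel is bounded below on \<open>(-1, 1)\<close>, the indicator divided
  by the kernel is an admissible test function (\<open>small_ball_local_limit\<close>). The rest is the
  computation of the characteristic function of one step (\<open>char_step_law\<close>) and its comparison with a
  Gaussian (\<open>walk_small_ball_limit\<close>).
\<close>

section \<open>Bounds on the cosine\<close>

lemma cos_quartic_bound: "cos x \<le> 1 - x\<^sup>2 / 2 + x ^ 4 / (24::real)"
proof -
  obtain t where "cos x = (\<Sum>m<4. cos_coeff m * x ^ m) + cos (t + 1/2 * real 4 * pi) / fact 4 * x ^ 4"
    using Maclaurin_cos_expansion[of x 4] by blast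
  then have "cos x = 1 - x\<^sup>2 / 2 + cos (t + 2 * pi) / 24 * x ^ 4"
    by (simp add: cos_coeff_def lessThan_nat_numeral fact_numeral)
  moreover have "cos t * x ^ 4 \<le> 1 * x ^ 4"
    by (rule mult_right_mono) auto
  ultimately show ?thesis by simp
qed

lemma cos_quadratic_bound: "1 - x\<^sup>2 / 2 \<le> cos (x::real)"
proof -
  have "cos x = 1 - 2 * (sin (x / 2))\<^sup>2"
    using cos_double_sin[of "x / 2"] by simp
  moreover have "(sin (x / 2))\<^sup>2 \<le> (x / 2)\<^sup>2"
    using abs_sin_x_le_abs_x[of "x / 2"] by (simp only: abs_le_square_iff)
  ultimately show ?thesis by (simp add: power_divide)
qed

section \<open>The triangular distribution and the Fejer kernel\<close>

definition triangle :: "real \<Rightarrow> real" where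
  "triangle t = max 0 (1 - \<bar>t\<bar>)"

text \<open>
  The Fejer kernel. The value at 0 is the continuous extension of the formula, so that the
  kernel is the characteristic function of the triangular distribution at every point.
\<close>
definition fejer :: "real \<Rightarrow> real" where
  "fejer x = (if x = 0 then 1 else 2 * (1 - cos x) / x\<^sup>2)"

abbreviation triangular_distribution :: "real measure" where
  "triangular_distribution \<equiv> density lborel triangle"

lemma triangle_nonneg [simp]: "0 \<le> triangle t"
  by (simp add: triangle_def)

lemma triangle_le_1: "triangle t \<le> 1"
  by (simp add: triangle_def)

lemma triangle_minus [simp]: "triangle (- t) = triangle t"
  by (simp add: triangle_def)

lemma triangle_measurable [measurable]: "triangle \<in> borel_measurable borel"
  unfolding triangle_def by measurable

lemma continuous_triangle: "isCont triangle t"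
  unfolding triangle_def by (intro continuous_intros)

text \<open>
  The weight \<open>triangle\<close> is affine on \<open>[-1, 0]\<close> and on \<open>[0, 1]\<close>, so integrals against it follow
  from antiderivatives on the two halves. This serves both for the total mass and for the
  characteristic function.
\<close>
lemma triangle_integral_split:
  fixes f :: "real \<Rightarrow> 'a::euclidean_space"
  assumes f: "continuous_on UNIV f"
    and F: "\<And>t. t \<in> {-1..0} \<Longrightarrow> (F has_vector_derivative (1 + t) *\<^sub>R f t) (at t within {-1..0})"
    and G: "\<And>t. t \<in> {0..1} \<Longrightarrow> (G has_vector_derivative (1 - t) *\<^sub>R f t) (at t within {0..1})"
  shows "integrable lborel (\<lambda>t. triangle t *\<^sub>R f t)"
    and "(LINT t|lborel. triangle t *\<^sub>R f t) = (F 0 - F (-1)) + (G 1 - G 0)"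
proof -
  let ?l = "\<lambda>t. indicator {-1..0} t *\<^sub>R ((1 + t) *\<^sub>R f t)"
  let ?r = "\<lambda>t. indicator {0..1} t *\<^sub>R ((1 - t) *\<^sub>R f t)"
  have [measurable]: "f \<in> borel_measurable borel"
    using f by (rule borel_measurable_continuous_onI)
  have cont: "continuous_on A f" for A
    using f continuous_on_subset by blast
  have int: "integrable lborel ?l" "integrable lborel ?r"
    unfolding set_integrable_def[symmetric]
    by (intro borel_integrable_atLeastAtMost' continuous_intros cont)+
  \<comment> \<open>Both halves contain the point 0, hence only almost everywhere.\<close>
  have ae: "AE t in lborel. ?l t + ?r t = triangle t *\<^sub>R f t"
    using AE_lborel_singleton[of 0]
    by eventually_elim (auto simp: triangle_def indicator_def)
  show "integrable lborel (\<lambda>t. triangle t *\<^sub>R f t)"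
    using Bochner_Integration.integrable_add[OF int] by (rule integrable_cong_AE_imp) (use ae in auto)
  have "(LINT t|lborel. triangle t *\<^sub>R f t) = (LINT t|lborel. ?l t + ?r t)"
    by (rule integral_cong_AE) (use ae in auto)
  also have "\<dots> = (LINT t|lborel. ?l t) + (LINT t|lborel. ?r t)"
    by (rule Bochner_Integration.integral_add[OF int])
  also have "(LINT t|lborel. ?l t) = F 0 - F (-1)"
    by (rule integral_FTC_atLeastAtMost) (auto intro!: F continuous_intros cont)
  also have "(LINT t|lborel. ?r t) = G 1 - G 0"
    by (rule integral_FTC_atLeastAtMost) (auto intro!: G continuous_intros cont)
  finally show "(LINT t|lborel. triangle t *\<^sub>R f t) = (F 0 - F (-1)) + (G 1 - G 0)" .
qed

lemma triangle_integral:
  shows integrable_triangle: "integrable lborel triangle"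
    and integral_triangle: "(LINT t|lborel. triangle t) = 1"
proof -
  have "((\<lambda>t. t + t\<^sup>2 / 2) has_vector_derivative (1 + t) *\<^sub>R 1) (at t within A)"
    and "((\<lambda>t. t - t\<^sup>2 / 2) has_vector_derivative (1 - t) *\<^sub>R 1) (at t within A)" for t :: real and A
    by (auto intro!: derivative_eq_intros simp flip: has_real_derivative_iff_has_vector_derivative)
  note split = triangle_integral_split[OF _ this]
  show "integrable lborel triangle" "(LINT t|lborel. triangle t) = 1"
    using split by auto
qed

lemma real_distribution_triangular: "real_distribution triangular_distribution"
proof -
  have "prob_space triangular_distribution"
    by (rule prob_spaceI)
       (simp add: emeasure_density nn_integral_eq_integral[OF integrable_triangle] integral_triangle)
  then show ?thesis
    by (simp add: real_distribution_def real_distribution_axioms_def)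
qed

lemma char_triangular: "char triangular_distribution x = of_real (fejer x)"
proof (cases "x = 0")
  case True
  then show ?thesis
    using real_distribution.char_zero[OF real_distribution_triangular] by (simp add: fejer_def)
next
  case False
  define e where "e t = exp (\<i> * of_real (t * x))" for t :: real
  have e': "(e has_vector_derivative (\<i> * x * e t)) (at t within A)" for t A
    unfolding e_def of_real_mult
    by (rule has_vector_derivative_real_field) (auto intro!: derivative_eq_intros)
  define F where "F t = (1 + t) *\<^sub>R (e t / (\<i> * x)) + e t / x\<^sup>2" for t
  define G where "G t = (1 - t) *\<^sub>R (e t / (\<i> * x)) - e t / x\<^sup>2" for t
  have "(F has_vector_derivative (1 + t) *\<^sub>R e t) (at t within A)" for t A
    unfolding F_def using False
    by (auto intro!: derivative_eq_intros e'
             simp: divide_simps power2_eq_square scaleR_conv_of_real algebra_simps)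
  moreover have "(G has_vector_derivative (1 - t) *\<^sub>R e t) (at t within A)" for t A
    unfolding G_def using False
    by (auto intro!: derivative_eq_intros e'
             simp: divide_simps power2_eq_square scaleR_conv_of_real algebra_simps)
  moreover have "continuous_on UNIV e"
    unfolding e_def by (intro continuous_intros)
  ultimately have "(LINT t|lborel. triangle t *\<^sub>R e t) = (F 0 - F (-1)) + (G 1 - G 0)"
    by (intro triangle_integral_split)
  moreover have "char triangular_distribution x = (LINT t|lborel. triangle t *\<^sub>R e t)"
    unfolding char_def e_def by (subst integral_density) (auto simp: mult.commute)
  ultimately have "char triangular_distribution x = (F 0 - F (-1)) + (G 1 - G 0)"
    by simp
  also have "\<dots> = (2 - (e 1 + e (-1))) / x\<^sup>2"
    by (simp add: F_def G_def e_def diff_divide_distrib add_divide_distrib)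
  also have "e 1 + e (-1) = 2 * cos x"
    by (simp add: e_def cos_exp_eq flip: cos_of_real)
  finally show ?thesis
    using False by (simp add: fejer_def)
qed

lemma fejer_measurable [measurable]: "fejer \<in> borel_measurable borel"
  unfolding fejer_def by measurable

lemma fejer_nonneg: "0 \<le> fejer x"
  by (simp add: fejer_def)

lemma fejer_le_1: "fejer x \<le> 1"
  using real_distribution.cmod_char_le_1[OF real_distribution_triangular, of x] fejer_nonneg[of x]
  by (simp add: char_triangular)

lemma continuous_fejer: "isCont fejer x"
proof -
  have "isCont (\<lambda>x. Re (char triangular_distribution x)) x"
    by (intro isCont_Re real_distribution.isCont_char real_distribution_triangular)
  then show ?thesis by (simp add: char_triangular)
qed

text \<open>
  The kernel decays like \<open>4 / x\<^sup>2\<close> and is bounded by 1, so it is dominated by a multiple of the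
  Cauchy density.
\<close>
lemma integrable_fejer: "integrable lborel fejer"
proof (rule Bochner_Integration.integrable_bound)
  show "integrable lborel (\<lambda>x::real. 5 * inverse (1 + x\<^sup>2))"
    using integrable_inverse_1_plus_square by (simp add: set_integrable_def)
  have "fejer x \<le> 5 * inverse (1 + x\<^sup>2)" for x
  proof (cases "x\<^sup>2 \<le> 4")
    case True
    then have "1 \<le> 5 * inverse (1 + x\<^sup>2)"
      using sum_power2_ge_zero[of 1 x] by (simp add: field_simps add_pos_nonneg)
    then show ?thesis using fejer_le_1[of x] by linarith
  next
    case False
    then have x: "x \<noteq> 0" by auto
    have "fejer x \<le> 4 / x\<^sup>2"
      using x by (auto simp: fejer_def intro!: divide_right_mono) (smt (verit) cos_ge_minus_one)
    also have "\<dots> \<le> 5 * inverse (1 + x\<^sup>2)"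
      using False x by (simp add: field_simps add_pos_nonneg)
    finally show ?thesis .
  qed
  then show "AE x in lborel. norm (fejer x) \<le> norm (5 * inverse (1 + x\<^sup>2))"
    by (intro AE_I2) (smt (verit) fejer_nonneg real_norm_def)
qed simp

text \<open>
  The kernel has no zeros on the interval whose probability is wanted, so that one may divide by it
  there.
\<close>
lemma fejer_ge_half:
  assumes "- 1 \<le> x" "x \<le> 1"
  shows "1 / 2 \<le> fejer x"
proof (cases "x = 0")
  case False
  have "x\<^sup>2 * x\<^sup>2 \<le> 1 * x\<^sup>2"
    using assms by (intro mult_right_mono) (simp_all add: abs_square_le_1 abs_le_iff)
  then have "x ^ 4 \<le> x\<^sup>2"
    by (simp flip: power_add)
  then have "x\<^sup>2 / 2 \<le> 2 * (1 - cos x)"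
    using cos_quartic_bound[of x] zero_le_power2[of x] by argo
  then show ?thesis using False by (simp add: fejer_def field_simps)
qed (simp add: fejer_def)

section \<open>Fourier side of the Fejer kernel\<close>

text \<open>
  Fubini for the two ways to integrate \<open>iexp ((t + a) * x / r)\<close>. If the characteristic function of
  \<open>T\<close> is used as a test function at scale \<open>r\<close> and \<open>T\<close> has compact support, then only the values of
  the characteristic function of \<open>\<mu>\<close> at frequencies of order \<open>1 / r\<close> enter.
\<close>
lemma parseval_char:
  assumes "real_distribution T" "real_distribution \<mu>"
  shows "(LINT x|\<mu>. char T (x / r) * iexp (a * (x / r))) = (LINT t|T. char \<mu> ((t + a) / r))"
proof -
  interpret T: real_distribution T by fact
  interpret \<mu>: real_distribution \<mu> by fact
  interpret pair_prob_space T \<mu> ..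
  define f where "f t x = iexp ((t + a) / r * x)" for t x :: real
  have [measurable]: "case_prod f \<in> borel_measurable (T \<Otimes>\<^sub>M \<mu>)"
    unfolding f_def by measurable
  have "integrable (T \<Otimes>\<^sub>M \<mu>) (case_prod f)"
    by (rule P.integrable_const_bound[of _ 1]) (auto simp: f_def simp del: of_real_divide)
  then have "(LINT x|\<mu>. LINT t|T. f t x) = (LINT t|T. LINT x|\<mu>. f t x)"
    by (rule Fubini_integral)
  moreover have "(LINT t|T. f t x) = char T (x / r) * iexp (a * (x / r))" for x
  proof -
    have "f t x = iexp (t * (x / r)) * iexp (a * (x / r))" for t
      by (simp add: f_def add_divide_distrib algebra_simps flip: exp_add)
    then show ?thesis
      by (simp add: char_def mult.commute[of x])
  qed
  ultimately show ?thesis by (simp add: char_def f_def)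
qed

lemma exp_half_square:
  shows integrable_exp_half_square: "integrable lborel (\<lambda>v::real. exp (- v\<^sup>2 / 2))"
    and integral_exp_half_square: "(LINT v|lborel. exp (- v\<^sup>2 / 2)) = sqrt (2 * pi)"
proof -
  have eq: "exp (- v\<^sup>2 / 2) = sqrt (2 * pi) * std_normal_density v" for v :: real
    by (simp add: std_normal_density_def)
  show "integrable lborel (\<lambda>v::real. exp (- v\<^sup>2 / 2))"
    unfolding eq by simp
  show "(LINT v|lborel. exp (- v\<^sup>2 / 2)) = sqrt (2 * pi)"
    unfolding eq by simp
qed

text \<open>
  By Parseval and the substitution \<open>t = r v - a\<close> the integral divided by \<open>r\<close> equals the integral of
  \<open>triangle (r v - a) * char \<mu> v\<close>. The triangle restricts \<open>v\<close> to \<open>\<bar>v\<bar> \<le> (1 + \<bar>a\<bar>) / r\<close>, where the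
  Gaussian bound is assumed, so dominated convergence applies; in the limit \<open>r \<rightarrow> 0\<close> the triangle
  becomes the constant \<open>triangle a\<close> and the characteristic function becomes Gaussian.
\<close>
lemma tilted_char_asymptotics:
  fixes \<mu> :: "nat \<Rightarrow> real measure" and r :: "nat \<Rightarrow> real"
  assumes \<mu>: "\<And>n. real_distribution (\<mu> n)"
    and r: "\<And>n. 0 < r n" "r \<longlonglongrightarrow> 0"
    and conv: "\<And>t. (\<lambda>n. char (\<mu> n) t) \<longlonglongrightarrow> of_real (exp (- t\<^sup>2 / 2))"
    and dom: "\<And>K. \<forall>\<^sub>F n in sequentially. \<forall>t. \<bar>t\<bar> \<le> K / r n \<longrightarrow> cmod (char (\<mu> n) t) \<le> exp (- t\<^sup>2 / 4)"
  shows "(\<lambda>n. (LINT x|\<mu> n. fejer (x / r n) * iexp (a * (x / r n))) / r n)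
           \<longlonglongrightarrow> of_real (sqrt (2 * pi) * triangle a)"
proof -
  define g where "g n v = triangle (r n * v - a) *\<^sub>R char (\<mu> n) v" for n v
  have [measurable]: "char (\<mu> n) \<in> borel_measurable borel" for n
    by (rule real_distribution.char_measurable[OF \<mu>])
  have [measurable]: "g n \<in> borel_measurable borel" for n
    unfolding g_def by measurable
  have eq: "(LINT x|\<mu> n. fejer (x / r n) * iexp (a * (x / r n))) / r n = (LINT v|lborel. g n v)" for n
  proof -
    have "(LINT x|\<mu> n. fejer (x / r n) * iexp (a * (x / r n)))
            = (LINT t|triangular_distribution. char (\<mu> n) ((t + a) / r n))"
      using parseval_char[OF real_distribution_triangular \<mu>] by (simp add: char_triangular)
    also have "\<dots> = (LINT t|lborel. triangle t *\<^sub>R char (\<mu> n) ((t + a) / r n))"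
      by (rule integral_density) auto
    also have "\<dots> = \<bar>r n\<bar> *\<^sub>R (LINT v|lborel. g n v)"
      using r(1)[of n]
      by (subst lborel_integral_real_affine[of "r n" _ "- a"]) (auto simp: g_def[abs_def])
    finally show ?thesis using r(1)[of n] by (simp add: scaleR_conv_of_real)
  qed
  have "\<forall>\<^sub>F n in sequentially. \<forall>v. norm (g n v) \<le> exp (- v\<^sup>2 / 4)"
    using dom[of "1 + \<bar>a\<bar>"]
  proof eventually_elim
    case (elim n)
    show ?case
    proof
      fix v
      show "norm (g n v) \<le> exp (- v\<^sup>2 / 4)"
      proof (cases "triangle (r n * v - a) = 0")
        case False
        then have "\<bar>r n * v\<bar> \<le> 1 + \<bar>a\<bar>" by (auto simp: triangle_def)
        then have "\<bar>v\<bar> \<le> (1 + \<bar>a\<bar>) / r n"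
          using r(1)[of n] by (simp add: abs_mult field_simps)
        then have "triangle (r n * v - a) * cmod (char (\<mu> n) v) \<le> 1 * exp (- v\<^sup>2 / 4)"
          using elim by (intro mult_mono) (auto simp: triangle_le_1)
        then show ?thesis by (simp add: g_def)
      qed (simp add: g_def)
    qed
  qed
  then obtain n0 where n0: "\<And>n v. n \<ge> n0 \<Longrightarrow> norm (g n v) \<le> exp (- v\<^sup>2 / 4)"
    by (auto simp: eventually_sequentially)
  have "(\<lambda>n. LINT v|lborel. g (n + n0) v) \<longlonglongrightarrow> (LINT v|lborel. triangle a *\<^sub>R of_real (exp (- v\<^sup>2 / 2)))"
  proof (rule integral_dominated_convergence[where w = "\<lambda>v. exp (- v\<^sup>2 / 4)"])
    show "integrable lborel (\<lambda>v::real. exp (- v\<^sup>2 / 4))"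
      using lborel_integrable_real_affine[OF integrable_exp_half_square, of "1 / sqrt 2" 0]
      by (simp add: power_divide)
    show "AE v in lborel. (\<lambda>n. g (n + n0) v) \<longlonglongrightarrow> triangle a *\<^sub>R of_real (exp (- v\<^sup>2 / 2))"
    proof (rule AE_I2)
      fix v
      have "(\<lambda>n. triangle (r n * v - a)) \<longlonglongrightarrow> triangle (0 * v - a)"
        by (intro isCont_tendsto_compose[OF continuous_triangle] tendsto_intros r)
      then have "(\<lambda>n. g n v) \<longlonglongrightarrow> triangle a *\<^sub>R of_real (exp (- v\<^sup>2 / 2))"
        unfolding g_def by (intro tendsto_scaleR conv) simp
      then show "(\<lambda>n. g (n + n0) v) \<longlonglongrightarrow> triangle a *\<^sub>R of_real (exp (- v\<^sup>2 / 2))"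
        by (rule LIMSEQ_ignore_initial_segment)
    qed
    show "AE v in lborel. norm (g (n + n0) v) \<le> exp (- v\<^sup>2 / 4)" for n
      by (intro AE_I2 n0) simp
  qed auto
  also have "(LINT v|lborel. triangle a *\<^sub>R complex_of_real (exp (- v\<^sup>2 / 2)))
      = of_real (sqrt (2 * pi) * triangle a)"
    using integral_exp_half_square
    by (simp add: scaleR_conv_of_real integral_complex_of_real del: exp_of_real flip: of_real_exp)
  finally show ?thesis
    unfolding eq by (rule LIMSEQ_offset)
qed

text \<open>
  Fourier inversion for the triangle. For the standard normal law the integral in
  \<open>tilted_char_asymptotics\<close> can also be evaluated from its density, which at the scale
  \<open>r \<rightarrow> 0\<close> is the constant \<open>1 / sqrt (2 * pi)\<close>. Comparing the two limits gives the transform of the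
  Fejer kernel.
\<close>
lemma fourier_fejer: "(CLINT x|lborel. fejer x *\<^sub>R iexp (a * x)) = of_real (2 * pi * triangle a)"
proof -
  define r where "r n = inverse (real (Suc n))" for n
  have r: "0 < r n" for n
    by (simp add: r_def)
  have r0: "r \<longlonglongrightarrow> 0"
    unfolding r_def by (rule LIMSEQ_inverse_real_of_nat)
  have "(\<lambda>n. (LINT x|std_normal_distribution. fejer (x / r n) * iexp (a * (x / r n))) / r n)
           \<longlonglongrightarrow> of_real (sqrt (2 * pi) * triangle a)"
  proof (rule tilted_char_asymptotics)
    show "real_distribution std_normal_distribution"
      by (rule real_dist_normal_dist)
    show "(\<lambda>n. char std_normal_distribution t) \<longlonglongrightarrow> of_real (exp (- t\<^sup>2 / 2))" for t
      by (simp add: char_std_normal_distribution)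
    show "\<forall>\<^sub>F n in sequentially. \<forall>t. \<bar>t\<bar> \<le> K / r n \<longrightarrow>
            cmod (char std_normal_distribution t) \<le> exp (- t\<^sup>2 / 4)" for K
      by (simp add: char_std_normal_distribution)
  qed (fact r r0)+
  moreover have "(LINT x|std_normal_distribution. fejer (x / r n) * iexp (a * (x / r n))) / r n
      = (LINT x|lborel. std_normal_density (r n * x) *\<^sub>R (fejer x *\<^sub>R iexp (a * x)))" for n
  proof -
    have "(LINT x|std_normal_distribution. fejer (x / r n) * iexp (a * (x / r n)))
       = (LINT x|lborel. std_normal_density x *\<^sub>R (fejer (x / r n) * iexp (a * (x / r n))))"
      by (rule integral_density) auto
    also have "\<dots> = \<bar>r n\<bar> *\<^sub>R (LINT x|lborel. std_normal_density (r n * x) *\<^sub>R (fejer x *\<^sub>R iexp (a * x)))"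
      using r[of n]
      by (subst lborel_integral_real_affine[of "r n" _ 0]) (auto simp: scaleR_conv_of_real)
    finally show ?thesis
      using r[of n] by (simp add: scaleR_conv_of_real)
  qed
  moreover have "(\<lambda>n. LINT x|lborel. std_normal_density (r n * x) *\<^sub>R (fejer x *\<^sub>R iexp (a * x)))
      \<longlonglongrightarrow> (LINT x|lborel. (1 / sqrt (2 * pi)) *\<^sub>R (fejer x *\<^sub>R iexp (a * x)))"
  proof (rule integral_dominated_convergence[where w = fejer])
    show "integrable lborel fejer"
      by (rule integrable_fejer)
    show "AE x in lborel. (\<lambda>n. std_normal_density (r n * x) *\<^sub>R (fejer x *\<^sub>R iexp (a * x)))
        \<longlonglongrightarrow> (1 / sqrt (2 * pi)) *\<^sub>R (fejer x *\<^sub>R iexp (a * x))"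
    proof (rule AE_I2)
      fix x :: real
      have "(\<lambda>n. std_normal_density (r n * x)) \<longlonglongrightarrow> 1 / sqrt (2 * pi) * exp (- (0 * x)\<^sup>2 / 2)"
        unfolding std_normal_density_def by (intro tendsto_intros r0) simp
      then show "(\<lambda>n. std_normal_density (r n * x) *\<^sub>R (fejer x *\<^sub>R iexp (a * x)))
          \<longlonglongrightarrow> (1 / sqrt (2 * pi)) *\<^sub>R (fejer x *\<^sub>R iexp (a * x))"
        by (intro tendsto_intros) simp
    qed
    show "AE x in lborel. norm (std_normal_density (r n * x) *\<^sub>R (fejer x *\<^sub>R iexp (a * x))) \<le> fejer x" for n
    proof (rule AE_I2)
      fix x :: real
      have "std_normal_density (r n * x) \<le> 1 / 1 * 1"
        unfolding std_normal_density_def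
        using pi_ge_two by (intro mult_mono divide_left_mono) (auto simp: real_le_rsqrt)
      then have "std_normal_density (r n * x) * fejer x \<le> 1 * fejer x"
        by (intro mult_right_mono fejer_nonneg) simp
      then show "norm (std_normal_density (r n * x) *\<^sub>R (fejer x *\<^sub>R iexp (a * x))) \<le> fejer x"
        by (simp add: fejer_nonneg)
    qed
  qed auto
  ultimately have "of_real (sqrt (2 * pi) * triangle a)
      = (LINT x|lborel. (1 / sqrt (2 * pi)) *\<^sub>R (fejer x *\<^sub>R iexp (a * x)))"
    using LIMSEQ_unique by simp
  also have "\<dots> = (1 / sqrt (2 * pi)) *\<^sub>R (LINT x|lborel. fejer x *\<^sub>R iexp (a * x))"
    by (rule integral_scaleR_right)
  finally have "(LINT x|lborel. fejer x *\<^sub>R iexp (a * x))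
      = of_real (sqrt (2 * pi)) * of_real (sqrt (2 * pi) * triangle a)"
    by (simp add: scaleR_conv_of_real)
  also have "\<dots> = of_real (2 * pi * triangle a)"
    by (simp flip: of_real_mult add: mult.assoc[symmetric])
  finally show ?thesis .
qed

lemma integral_fejer: "(LINT x|lborel. fejer x) = 2 * pi"
proof -
  have "complex_of_real (LINT x|lborel. fejer x) = of_real (2 * pi)"
    using fourier_fejer[of 0]
    by (simp add: triangle_def scaleR_conv_of_real flip: integral_complex_of_real)
  then show ?thesis by (simp only: of_real_eq_iff)
qed

section \<open>Probabilities of intervals shorter than the Gaussian scale\<close>

abbreviation fejer_distribution :: "real measure" where
  "fejer_distribution \<equiv> density lborel (\<lambda>x. fejer x / (2 * pi))"

lemma integral_fejer_distribution:
  fixes f :: "real \<Rightarrow> 'a::{banach, second_countable_topology}"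
  assumes "f \<in> borel_measurable borel"
  shows "(LINT x|fejer_distribution. f x) = (LINT x|lborel. (fejer x / (2 * pi)) *\<^sub>R f x)"
  by (rule integral_density) (use assms in \<open>auto simp: fejer_nonneg\<close>)

lemma real_distribution_fejer: "real_distribution fejer_distribution"
proof -
  have "integrable lborel (\<lambda>x. fejer x / (2 * pi))"
    using integrable_fejer by simp
  then have "(\<integral>\<^sup>+x. ennreal (fejer x / (2 * pi)) \<partial>lborel) = ennreal (LINT x|lborel. fejer x / (2 * pi))"
    by (rule nn_integral_eq_integral) (simp add: fejer_nonneg)
  also have "(LINT x|lborel. fejer x / (2 * pi)) = 1"
    by (simp add: integral_fejer)
  finally have "prob_space fejer_distribution"
    by (intro prob_spaceI) (simp add: emeasure_density)
  then show ?thesis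
    by (simp add: real_distribution_def real_distribution_axioms_def)
qed

lemma char_fejer_distribution: "char fejer_distribution a = of_real (triangle a)"
proof -
  have "char fejer_distribution a = (LINT x|lborel. (fejer x / (2 * pi)) *\<^sub>R iexp (a * x))"
    unfolding char_def by (rule integral_fejer_distribution) simp
  also have "\<dots> = (LINT x|lborel. (1 / (2 * pi)) *\<^sub>R (fejer x *\<^sub>R iexp (a * x)))"
    by simp
  also have "\<dots> = (1 / (2 * pi)) *\<^sub>R (LINT x|lborel. fejer x *\<^sub>R iexp (a * x))"
    by (rule integral_scaleR_right)
  finally show ?thesis
    by (simp only: fourier_fejer) (simp add: scaleR_conv_of_real)
qed

text \<open>
  Weighting \<open>\<mu> n\<close>, rescaled by \<open>r n\<close>, with the Fejer kernel and normalising gives probability measures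
  \<open>\<nu> n\<close> whose characteristic functions converge to the triangle, that is, to the one of the law with
  density proportional to the kernel. By Levy's continuity theorem they converge weakly. Testing this
  with the indicator of \<open>(-1, 1)\<close> divided by the kernel removes the weight again, and what
  remains is the probability of \<open>(-r n, r n)\<close> divided by the normalising constant \<open>c n\<close>, which is
  asymptotic to \<open>sqrt (2 * pi) * r n\<close>.
\<close>
theorem small_ball_local_limit:
  fixes \<mu> :: "nat \<Rightarrow> real measure" and r :: "nat \<Rightarrow> real"
  assumes \<mu>: "\<And>n. real_distribution (\<mu> n)"
    and r: "\<And>n. 0 < r n" "r \<longlonglongrightarrow> 0"
    and conv: "\<And>t. (\<lambda>n. char (\<mu> n) t) \<longlonglongrightarrow> of_real (exp (- t\<^sup>2 / 2))"
    and dom: "\<And>K. \<forall>\<^sub>F n in sequentially. \<forall>t. \<bar>t\<bar> \<le> K / r n \<longrightarrow> cmod (char (\<mu> n) t) \<le> exp (- t\<^sup>2 / 4)"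
  shows "(\<lambda>n. measure (\<mu> n) {- r n<..<r n} / r n) \<longlonglongrightarrow> 2 / sqrt (2 * pi)"
proof -
  interpret \<mu>: real_distribution "\<mu> n" for n by (rule \<mu>)
  define I where "I n a = (LINT x|\<mu> n. fejer (x / r n) * iexp (a * (x / r n)))" for n a
  define c where "c n = (LINT x|\<mu> n. fejer (x / r n))" for n
  have I: "(\<lambda>n. I n a / r n) \<longlonglongrightarrow> of_real (sqrt (2 * pi) * triangle a)" for a
    unfolding I_def by (rule tilted_char_asymptotics[OF \<mu> r conv dom])
  have "(\<lambda>n. complex_of_real (c n / r n)) \<longlonglongrightarrow> of_real (sqrt (2 * pi))"
    using I[of 0] by (simp add: I_def c_def triangle_def)
  then have c: "(\<lambda>n. c n / r n) \<longlonglongrightarrow> sqrt (2 * pi)"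
    by (simp only: tendsto_of_real_iff)
  \<comment> \<open>For small \<open>n\<close> all mass of \<open>\<mu> n\<close> may sit on zeros of the kernel, where no normalisation is possible.\<close>
  have "\<forall>\<^sub>F n in sequentially. c n / r n > 0"
    by (rule order_tendstoD[OF c]) simp
  then obtain n0 where "\<And>n. n \<ge> n0 \<Longrightarrow> c n / r n > 0"
    by (auto simp: eventually_sequentially)
  then have c_pos: "c (n + n0) > 0" for n
    using r(1)[of "n + n0"] by (metis le_add2 zero_less_divide_iff not_less_iff_gr_or_eq)
  define \<nu> where "\<nu> n = distr (density (\<mu> n) (\<lambda>x. fejer (x / r n) / c n)) borel (\<lambda>x. x / r n)" for n
  have int_\<nu>: "(LINT x|\<nu> (n + n0). f x) =
        (LINT x|\<mu> (n + n0). (fejer (x / r (n + n0)) / c (n + n0)) *\<^sub>R f (x / r (n + n0)))"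
    if [measurable]: "f \<in> borel_measurable borel"
    for n and f :: "real \<Rightarrow> 'b::{banach, second_countable_topology}"
    unfolding \<nu>_def using c_pos[of n]
    by (subst integral_distr) (auto simp: integral_density fejer_nonneg)
  have \<nu>: "real_distribution (\<nu> (n + n0))" for n
  proof -
    let ?m = "n + n0"
    have "integrable (\<mu> ?m) (\<lambda>x. fejer (x / r ?m))"
      by (rule \<mu>.integrable_const_bound[of _ 1]) (auto simp: fejer_nonneg fejer_le_1)
    then have "integrable (\<mu> ?m) (\<lambda>x. fejer (x / r ?m) / c ?m)"
      by simp
    moreover have "(LINT x|\<mu> ?m. fejer (x / r ?m) / c ?m) = 1"
      using c_pos[of n] by (simp add: c_def)
    ultimately have "prob_space (density (\<mu> ?m) (\<lambda>x. fejer (x / r ?m) / c ?m))"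
      using c_pos[of n]
      by (intro prob_spaceI) (simp add: emeasure_density nn_integral_eq_integral fejer_nonneg)
    then show ?thesis
      unfolding \<nu>_def by (rule prob_space.real_distribution_distr) measurable
  qed
  have "(\<lambda>n. char (\<nu> (n + n0)) a) \<longlonglongrightarrow> char fejer_distribution a" for a
  proof -
    have "(\<lambda>n. (I n a / r n) / of_real (c n / r n))
        \<longlonglongrightarrow> of_real (sqrt (2 * pi) * triangle a) / of_real (sqrt (2 * pi))"
      by (intro tendsto_divide I tendsto_of_real c) simp
    then have "(\<lambda>n. I (n + n0) a / of_real (c (n + n0))) \<longlonglongrightarrow> of_real (triangle a)"
      using r(1) by (intro LIMSEQ_ignore_initial_segment) (simp add: less_imp_neq[THEN not_sym])
    moreover have "char (\<nu> (n + n0)) a = I (n + n0) a / of_real (c (n + n0))" for n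
    proof -
      have "char (\<nu> (n + n0)) a = (LINT x|\<mu> (n + n0). (fejer (x / r (n + n0)) / c (n + n0)) *\<^sub>R
              iexp (a * (x / r (n + n0))))"
        unfolding char_def by (rule int_\<nu>) simp
      then show ?thesis
        by (simp add: I_def scaleR_conv_of_real flip: integral_divide_zero)
    qed
    ultimately show ?thesis
      by (simp add: char_fejer_distribution)
  qed
  then have weak: "weak_conv_m (\<lambda>n. \<nu> (n + n0)) fejer_distribution"
    by (intro levy_continuity \<nu> real_distribution_fejer)
  define f :: "real \<Rightarrow> real" where "f x = indicator {-1<..<1} x / fejer x" for x
  have f_meas [measurable]: "f \<in> borel_measurable borel"
    unfolding f_def by measurable
  have fejer_f: "fejer x * f x = indicator {-1<..<1} x" for x
    using fejer_ge_half[of x] by (auto simp: f_def indicator_def)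
  have lim: "(\<lambda>n. LINT x|\<nu> (n + n0). f x) \<longlonglongrightarrow> (LINT x|fejer_distribution. f x)"
  proof (rule weak_conv_imp_bdd_ae_continuous_conv[OF \<nu> real_distribution_fejer weak, where B = 2])
    show "norm (f x) \<le> 2" for x
      using fejer_ge_half[of x] by (auto simp: f_def indicator_def field_simps)
    have "isCont f x" if "x \<notin> {-1, 1}" for x
    proof (cases "x \<in> {-1<..<1}")
      case True
      have "isCont (\<lambda>x. 1 / fejer x) x"
        using True fejer_ge_half[of x] by (intro continuous_intros continuous_fejer) auto
      moreover have "\<forall>\<^sub>F y in nhds x. f y = 1 / fejer y"
        using eventually_nhds_in_open[of "{-1<..<1}" x] True by (auto elim!: eventually_mono simp: f_def)
      ultimately show ?thesis by (simp add: isCont_cong)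
    next
      case False
      have "\<forall>\<^sub>F y in nhds x. f y = 0"
        using eventually_nhds_in_open[of "- {-1..1}" x, OF open_Compl[OF closed_atLeastAtMost]]
          that False
        by (auto elim!: eventually_mono simp: f_def indicator_def)
      then show ?thesis by (simp add: isCont_cong)
    qed
    then have "{x. \<not> isCont f x} \<subseteq> {-1, 1}" by blast
    moreover have "{-1, 1} \<in> null_sets fejer_distribution"
      using absolutely_continuousI_density[of "\<lambda>x. fejer x / (2 * pi)" lborel]
        finite_imp_null_set_lborel[of "{-1, 1}"]
      by (auto simp: absolutely_continuous_def)
    ultimately show "emeasure fejer_distribution {x. \<not> isCont f x} = 0"
      by (meson emeasure_eq_0 null_setsD1 null_setsD2)
  qed (rule f_meas)
  have "(LINT x|fejer_distribution. f x) = (LINT x|lborel. indicator {-1<..<1::real} x / (2 * pi))"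
    by (subst integral_fejer_distribution) (simp_all add: fejer_f)
  also have "\<dots> = measure lborel {-1<..<1::real} / (2 * pi)"
    by simp
  also have "measure lborel {-1<..<1::real} = 2"
    by (subst measure_lborel_Ioo) simp_all
  finally have lim_val: "(LINT x|fejer_distribution. f x) = 1 / pi"
    by simp
  have \<nu>_val: "(LINT x|\<nu> (n + n0). f x) = measure (\<mu> (n + n0)) {- r (n + n0)<..<r (n + n0)} / c (n + n0)" for n
  proof -
    let ?m = "n + n0"
    have "indicator {-1<..<1} (x / r ?m) = (indicator {- r ?m<..<r ?m} x :: real)" for x
      using r(1)[of ?m] by (auto simp: indicator_def field_simps)
    then have "(LINT x|\<nu> ?m. f x) = (LINT x|\<mu> ?m. indicator {- r ?m<..<r ?m} x / c ?m)"
      by (subst int_\<nu>) (simp_all add: fejer_f)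
    then show ?thesis by simp
  qed
  have "(\<lambda>n. measure (\<mu> (n + n0)) {- r (n + n0)<..<r (n + n0)} / c (n + n0) * (c (n + n0) / r (n + n0)))
      \<longlonglongrightarrow> 1 / pi * sqrt (2 * pi)"
    using lim unfolding lim_val \<nu>_val by (intro tendsto_mult LIMSEQ_ignore_initial_segment[OF c])
  moreover have "measure (\<mu> (n + n0)) {- r (n + n0)<..<r (n + n0)} / c (n + n0) * (c (n + n0) / r (n + n0))
      = measure (\<mu> (n + n0)) {- r (n + n0)<..<r (n + n0)} / r (n + n0)" for n
    using c_pos[of n] by simp
  moreover have "1 / pi * sqrt (2 * pi) = 2 / sqrt (2 * pi)"
    by (simp add: field_simps)
  ultimately have "(\<lambda>n. measure (\<mu> (n + n0)) {- r (n + n0)<..<r (n + n0)} / r (n + n0))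
      \<longlonglongrightarrow> 2 / sqrt (2 * pi)"
    by (simp only:)
  then show ?thesis by (rule LIMSEQ_offset)
qed

section \<open>Random walks with a quartic expansion of the characteristic function\<close>

text \<open>
  Squeeze \<open>\<phi> ^ m\<close> between \<open>(1 + x / m) ^ m\<close> and \<open>exp (x + O(1 / m))\<close> with \<open>x = - t\<^sup>2 / 2\<close>; the upper bound
  is \<open>1 + y \<le> exp y\<close>.
\<close>
lemma power_tendsto_gaussian:
  fixes \<phi> :: "real \<Rightarrow> real" and m :: "nat \<Rightarrow> nat"
  assumes \<sigma>: "\<sigma> > 0"
    and lower: "\<And>s. 1 - \<sigma>\<^sup>2 * s\<^sup>2 / 2 \<le> \<phi> s"
    and upper: "\<And>s. \<phi> s \<le> 1 - \<sigma>\<^sup>2 * s\<^sup>2 / 2 + C * s ^ 4"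
    and m: "filterlim m at_top sequentially"
  shows "(\<lambda>n. \<phi> (t / (\<sigma> * sqrt (m n))) ^ m n) \<longlonglongrightarrow> exp (- t\<^sup>2 / 2)"
proof (rule tendsto_sandwich)
  define x where "x = - t\<^sup>2 / 2"
  have sq: "\<sigma>\<^sup>2 * (t / (\<sigma> * sqrt k))\<^sup>2 / 2 = - (x / k)" if "k > 0" for k :: nat
    using \<sigma> that by (simp add: x_def power_divide power_mult_distrib)
  have quart: "(t / (\<sigma> * sqrt k)) ^ 4 = t ^ 4 / \<sigma> ^ 4 / k / k" if "k > 0" for k :: nat
  proof -
    have "sqrt k ^ 4 = (sqrt k ^ 2) ^ 2"
      by (simp only: power_mult[symmetric]) simp
    then show ?thesis
      using \<sigma> that by (simp add: power_divide power_mult_distrib power2_eq_square)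
  qed
  have m_real: "filterlim (\<lambda>n. real (m n)) at_top sequentially"
    by (rule filterlim_compose[OF filterlim_real_sequentially m])
  have m_pos: "\<forall>\<^sub>F n in sequentially. m n > 0"
    using filterlim_at_top[THEN iffD1, OF m, rule_format, of 1] by eventually_elim auto
  have x_m: "(\<lambda>n. x / m n) \<longlonglongrightarrow> 0"
    by (rule tendsto_divide_0[OF tendsto_const filterlim_at_top_imp_at_infinity[OF m_real]])
  have "\<forall>\<^sub>F n in sequentially. - 1 < x / m n"
    by (rule order_tendstoD(1)[OF x_m]) simp
  then have base_pos: "\<forall>\<^sub>F n in sequentially. 0 < 1 + x / m n"
    by eventually_elim linarith
  show "(\<lambda>n. (1 + x / m n) ^ m n) \<longlonglongrightarrow> exp (- t\<^sup>2 / 2)"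
    using filterlim_compose[OF tendsto_exp_limit_sequentially m, of x] by (simp add: x_def)
  show "\<forall>\<^sub>F n in sequentially. (1 + x / m n) ^ m n \<le> \<phi> (t / (\<sigma> * sqrt (m n))) ^ m n"
    using base_pos m_pos
  proof eventually_elim
    case (elim n)
    then show ?case
      using lower[of "t / (\<sigma> * sqrt (m n))"] sq[of "m n"] by (intro power_mono) auto
  qed
  show "\<forall>\<^sub>F n in sequentially. \<phi> (t / (\<sigma> * sqrt (m n))) ^ m n \<le> exp (x + C * (t ^ 4 / \<sigma> ^ 4) / m n)"
    using base_pos m_pos
  proof eventually_elim
    case (elim n)
    let ?s = "t / (\<sigma> * sqrt (m n))" and ?y = "x / m n + C * (t ^ 4 / \<sigma> ^ 4 / m n / m n)"
    have "0 \<le> \<phi> ?s"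
      using lower[of ?s] sq[of "m n"] elim by simp
    moreover have "\<phi> ?s \<le> 1 + ?y"
      using upper[of ?s] sq[of "m n"] quart[of "m n"] elim by simp
    ultimately have "\<phi> ?s ^ m n \<le> exp ?y ^ m n"
      by (intro power_mono order.trans[OF _ exp_ge_add_one_self])
    also have "\<dots> = exp (m n * ?y)"
      by (rule exp_of_nat_mult[symmetric])
    also have "m n * ?y = x + C * (t ^ 4 / \<sigma> ^ 4) / m n"
      using elim by (simp add: distrib_left)
    finally show ?case .
  qed
  have "(\<lambda>n. C * (t ^ 4 / \<sigma> ^ 4) / m n) \<longlonglongrightarrow> 0"
    by (rule tendsto_divide_0[OF tendsto_const filterlim_at_top_imp_at_infinity[OF m_real]])
  then have "(\<lambda>n. exp (x + C * (t ^ 4 / \<sigma> ^ 4) / m n)) \<longlonglongrightarrow> exp (x + 0)"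
    by (intro tendsto_intros)
  then show "(\<lambda>n. exp (x + C * (t ^ 4 / \<sigma> ^ 4) / m n)) \<longlonglongrightarrow> exp (- t\<^sup>2 / 2)"
    by (simp add: x_def)
qed

text \<open>
  Half of the exponent \<open>- \<sigma>\<^sup>2 * s\<^sup>2 / 2\<close> is given up in order to absorb the quartic error term.
\<close>
lemma gaussian_bound_near_0:
  fixes \<phi> :: "real \<Rightarrow> real"
  assumes \<sigma>: "\<sigma> > 0" and C: "C \<ge> 0"
    and lower: "\<And>s. 1 - \<sigma>\<^sup>2 * s\<^sup>2 / 2 \<le> \<phi> s"
    and upper: "\<And>s. \<phi> s \<le> 1 - \<sigma>\<^sup>2 * s\<^sup>2 / 2 + C * s ^ 4"
  obtains \<epsilon> where "\<epsilon> > 0" "\<And>s. \<bar>s\<bar> \<le> \<epsilon> \<Longrightarrow> \<bar>\<phi> s\<bar> \<le> exp (- \<sigma>\<^sup>2 * s\<^sup>2 / 4)"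
proof
  \<comment> \<open>The first bound makes \<open>\<phi>\<close> nonnegative, the second makes \<open>C * s ^ 4\<close> at most \<open>\<sigma>\<^sup>2 * s\<^sup>2 / 4\<close>;
    \<open>C + 1\<close> avoids a division by zero.\<close>
  define \<epsilon> where "\<epsilon> = sqrt (min (1 / \<sigma>\<^sup>2) (\<sigma>\<^sup>2 / (4 * (C + 1))))"
  show "\<epsilon> > 0"
    using \<sigma> C by (simp add: \<epsilon>_def)
  have \<epsilon>2: "\<epsilon>\<^sup>2 = min (1 / \<sigma>\<^sup>2) (\<sigma>\<^sup>2 / (4 * (C + 1)))"
    using \<sigma> C by (simp add: \<epsilon>_def)
  fix s assume "\<bar>s\<bar> \<le> \<epsilon>"
  then have "s\<^sup>2 \<le> \<epsilon>\<^sup>2"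
    by (metis abs_ge_zero power2_abs power_mono)
  then have s: "s\<^sup>2 \<le> 1 / \<sigma>\<^sup>2" "s\<^sup>2 \<le> \<sigma>\<^sup>2 / (4 * (C + 1))"
    unfolding \<epsilon>2 by auto
  then have "\<sigma>\<^sup>2 * s\<^sup>2 \<le> 1"
    using \<sigma> by (simp add: field_simps)
  then have "0 \<le> \<phi> s"
    using lower[of s] by linarith
  have "C * s\<^sup>2 \<le> (C + 1) * (\<sigma>\<^sup>2 / (4 * (C + 1)))"
    using s(2) C by (intro mult_mono) auto
  also have "\<dots> = \<sigma>\<^sup>2 / 4"
    using C by (simp add: field_simps)
  finally have "C * s\<^sup>2 * s\<^sup>2 \<le> \<sigma>\<^sup>2 / 4 * s\<^sup>2"
    by (rule mult_right_mono) simp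
  moreover have "C * s ^ 4 = C * s\<^sup>2 * s\<^sup>2"
    by (simp add: power2_eq_square power4_eq_xxxx)
  ultimately have "\<phi> s \<le> 1 - \<sigma>\<^sup>2 * s\<^sup>2 / 4"
    using upper[of s] by argo
  also have "\<dots> = 1 + (- \<sigma>\<^sup>2 * s\<^sup>2 / 4)"
    by simp
  also have "\<dots> \<le> exp (- \<sigma>\<^sup>2 * s\<^sup>2 / 4)"
    by (rule exp_ge_add_one_self)
  finally show "\<bar>\<phi> s\<bar> \<le> exp (- \<sigma>\<^sup>2 * s\<^sup>2 / 4)"
    using \<open>0 \<le> \<phi> s\<close> by simp
qed

text \<open>
  After normalisation by \<open>\<sigma> * sqrt m\<close> the window has half-width \<open>r = L / (\<sigma> * sqrt m) \<rightarrow> 0\<close>. A frequency of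
  order \<open>1 / r\<close> for the normalised walk is one of order \<open>1 / L\<close> for a single step. Since \<open>L\<close> tends to
  infinity these frequencies shrink to 0, so the Gaussian domination of the characteristic function
  follows from its expansion at 0 alone.
\<close>
theorem walk_small_ball_limit:
  fixes M :: "'a measure" and u :: "nat \<Rightarrow> 'a \<Rightarrow> real" and \<phi> :: "real \<Rightarrow> real"
    and m :: "nat \<Rightarrow> nat" and L :: "nat \<Rightarrow> real"
  assumes M: "prob_space M"
    and indep: "prob_space.indep_vars M (\<lambda>_. borel) u {1..}"
    and char_u: "\<And>j s. j \<ge> 1 \<Longrightarrow> char (distr M borel (u j)) s = of_real (\<phi> s)"
    and \<sigma>: "\<sigma> > 0" and C: "C \<ge> 0"
    and lower: "\<And>s. 1 - \<sigma>\<^sup>2 * s\<^sup>2 / 2 \<le> \<phi> s"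
    and upper: "\<And>s. \<phi> s \<le> 1 - \<sigma>\<^sup>2 * s\<^sup>2 / 2 + C * s ^ 4"
    and m: "filterlim m at_top sequentially" "\<And>n. m n > 0"
    and L: "filterlim L at_top sequentially" "\<And>n. L n > 0"
    and L_m: "(\<lambda>n. L n / sqrt (m n)) \<longlonglongrightarrow> 0"
  shows "(\<lambda>n. measure M {\<omega> \<in> space M. walk u (m n) \<omega> \<in> {- L n<..<L n}} * sqrt (m n) / L n)
           \<longlonglongrightarrow> 2 / (sqrt (2 * pi) * \<sigma>)"
proof -
  interpret prob_space M by fact
  define k where "k n = \<sigma> * sqrt (m n)" for n
  have k: "k n > 0" for n
    using \<sigma> m(2) by (simp add: k_def)
  define \<mu> where "\<mu> n = distr M borel (\<lambda>\<omega>. walk u (m n) \<omega> / k n)" for n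
  have u_meas: "u j \<in> borel_measurable M" if "j \<ge> 1" for j
    using indep that by (auto simp: indep_vars_def2)
  have [measurable]: "walk u n \<in> borel_measurable M" for n
    unfolding walk_def[abs_def] by (rule borel_measurable_sum) (simp add: u_meas)
  have \<mu>: "real_distribution (\<mu> n)" for n
    unfolding \<mu>_def by (rule real_distribution_distr) measurable
  have char_\<mu>: "char (\<mu> n) t = of_real (\<phi> (t / k n) ^ m n)" for n t
  proof -
    have "char (\<mu> n) t = char (distr M borel (walk u (m n))) (t / k n)"
      by (simp add: \<mu>_def char_def integral_distr)
    also have "\<dots> = char (distr M borel (\<lambda>\<omega>. \<Sum>j=1..m n. u j \<omega>)) (t / k n)"
      by (simp only: walk_def[abs_def])
    also have "\<dots> = (\<Prod>j=1..m n. char (distr M borel (u j)) (t / k n))"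
      by (rule char_distr_sum) (rule indep_vars_subset[OF indep], auto)
    also have "\<dots> = of_real (\<phi> (t / k n) ^ m n)"
      by (simp add: char_u)
    finally show ?thesis .
  qed
  have r: "L n / k n > 0" for n
    using k L(2) by simp
  have r0: "(\<lambda>n. L n / k n) \<longlonglongrightarrow> 0"
    using tendsto_divide[OF L_m tendsto_const[of \<sigma>]] \<sigma> by (simp add: k_def mult.commute)
  have "(\<lambda>n. measure (\<mu> n) {- (L n / k n)<..<L n / k n} / (L n / k n)) \<longlonglongrightarrow> 2 / sqrt (2 * pi)"
  proof (rule small_ball_local_limit[OF \<mu> r r0])
    show "(\<lambda>n. char (\<mu> n) t) \<longlonglongrightarrow> of_real (exp (- t\<^sup>2 / 2))" for t
      unfolding char_\<mu> k_def
      by (intro tendsto_of_real power_tendsto_gaussian[OF \<sigma> lower upper m(1)])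
    obtain \<epsilon> where \<epsilon>: "\<epsilon> > 0" "\<And>s. \<bar>s\<bar> \<le> \<epsilon> \<Longrightarrow> \<bar>\<phi> s\<bar> \<le> exp (- \<sigma>\<^sup>2 * s\<^sup>2 / 4)"
      using gaussian_bound_near_0[OF \<sigma> C lower upper] by blast
    show "\<forall>\<^sub>F n in sequentially. \<forall>t. \<bar>t\<bar> \<le> K / (L n / k n) \<longrightarrow> cmod (char (\<mu> n) t) \<le> exp (- t\<^sup>2 / 4)" for K
      using filterlim_at_top[THEN iffD1, OF L(1), rule_format, of "K / \<epsilon>"]
    proof eventually_elim
      case (elim n)
      show ?case
      proof (intro allI impI)
        fix t assume "\<bar>t\<bar> \<le> K / (L n / k n)"
        then have "\<bar>t / k n\<bar> \<le> K / L n"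
          using k[of n] by (simp add: field_simps)
        also have "\<dots> \<le> \<epsilon>"
          using elim L(2)[of n] \<epsilon>(1) by (simp add: field_simps)
        finally have "\<bar>\<phi> (t / k n)\<bar> ^ m n \<le> exp (- \<sigma>\<^sup>2 * (t / k n)\<^sup>2 / 4) ^ m n"
          by (intro power_mono \<epsilon>(2)) auto
        also have "\<dots> = exp (m n * (- \<sigma>\<^sup>2 * (t / k n)\<^sup>2 / 4))"
          by (rule exp_of_nat_mult[symmetric])
        also have "m n * (- \<sigma>\<^sup>2 * (t / k n)\<^sup>2 / 4) = - t\<^sup>2 / 4"
          using \<sigma> m(2)[of n] by (simp add: k_def power_divide power_mult_distrib)
        finally show "cmod (char (\<mu> n) t) \<le> exp (- t\<^sup>2 / 4)"
          by (simp only: char_\<mu> norm_of_real power_abs)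
      qed
    qed
  qed
  then have "(\<lambda>n. measure (\<mu> n) {- (L n / k n)<..<L n / k n} / (L n / k n) / \<sigma>)
      \<longlonglongrightarrow> 2 / sqrt (2 * pi) / \<sigma>"
    by (rule tendsto_divide[OF _ tendsto_const]) (use \<sigma> in simp)
  moreover have "measure (\<mu> n) {- (L n / k n)<..<L n / k n}
      = measure M {\<omega> \<in> space M. walk u (m n) \<omega> \<in> {- L n<..<L n}}" for n
    unfolding \<mu>_def using k[of n]
    by (subst measure_distr) (auto intro!: arg_cong[where f = "measure M"] simp: field_simps)
  ultimately show ?thesis
    using \<sigma> by (simp add: k_def mult.assoc mult.left_commute)
qed

section \<open>The step law\<close>

text \<open>
  The step law as the image of a measure on a finite index set, which turns integrals into finite
  sums. A pair \<open>(i, b)\<close> stands for \<open>\<alpha> i\<close> with the sign \<open>b\<close>; index 0 occurs twice, with half of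
  \<open>p 0\<close> each time.
\<close>
definition atom :: "(nat \<Rightarrow> real) \<Rightarrow> nat \<times> bool \<Rightarrow> real" where
  "atom \<alpha> = (\<lambda>(i, b). if i = 0 then 0 else if b then \<alpha> i else - \<alpha> i)"

lemma sum_UNIV_bool: "(\<Sum>b\<in>UNIV. g b) = g True + g False"
  by (simp add: UNIV_bool add.commute)

lemma step_law_eq_distr:
  assumes "\<And>i. i \<le> N \<Longrightarrow> 0 \<le> p i"
  shows "step_law N p \<alpha> =
    distr (point_measure ({0..N} \<times> UNIV) (\<lambda>(i, b). p i / 2)) borel (atom \<alpha>)" (is "_ = ?D")
proof (rule measure_eqI)
  fix A :: "real set" assume "A \<in> sets (step_law N p \<alpha>)"
  then have A: "A \<in> sets borel" by (simp add: sets_step_law)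
  let ?f = "\<lambda>i b. ennreal (p i / 2) * indicator A (atom \<alpha> (i, b))"
  have "emeasure ?D A = (\<integral>\<^sup>+x. indicator A x \<partial>?D)"
    using A by (simp add: nn_integral_indicator)
  also have "\<dots> = (\<integral>\<^sup>+x. indicator A (atom \<alpha> x) \<partial>point_measure ({0..N} \<times> UNIV) (\<lambda>(i, b). p i / 2))"
    using A by (intro nn_integral_distr) (auto simp: measurable_point_measure_eq1)
  also have "\<dots> = (\<Sum>x\<in>{0..N} \<times> UNIV. ennreal (case x of (i, b) \<Rightarrow> p i / 2) * indicator A (atom \<alpha> x))"
    using assms by (subst nn_integral_point_measure_finite) auto
  also have "\<dots> = (\<Sum>i\<in>{0..N}. \<Sum>b\<in>UNIV. ?f i b)"
    by (subst sum.cartesian_product) (rule sum.cong, auto)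
  also have "\<dots> = (\<Sum>i\<in>{0..N}. ?f i True + ?f i False)"
    by (simp only: sum_UNIV_bool)
  also have "\<dots> = (?f 0 True + ?f 0 False) + (\<Sum>i=1..N. ?f i True + ?f i False)"
    by (simp add: sum.atLeast_Suc_atMost)
  also have "?f 0 True + ?f 0 False = ennreal (p 0) * emeasure (return borel 0) A"
    using A assms[of 0] by (simp add: atom_def flip: distrib_right ennreal_plus)
  also have "(\<Sum>i=1..N. ?f i True + ?f i False) = ennreal (1 / 2) * (\<Sum>i=1..N. ennreal (p i) *
       (emeasure (return borel (\<alpha> i)) A + emeasure (return borel (- \<alpha> i)) A))"
    unfolding sum_distrib_left
  proof (rule sum.cong)
    fix i assume "i \<in> {1..N}"
    then have "ennreal (1 / 2 * p i) = ennreal (1 / 2) * ennreal (p i)"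
      using assms[of i] by (intro ennreal_mult) auto
    then have "ennreal (p i / 2) = ennreal (1 / 2) * ennreal (p i)"
      by simp
    then show "?f i True + ?f i False = ennreal (1 / 2) * (ennreal (p i) *
       (emeasure (return borel (\<alpha> i)) A + emeasure (return borel (- \<alpha> i)) A))"
      using A \<open>i \<in> {1..N}\<close> by (simp add: atom_def distrib_left mult.assoc)
  qed simp
  finally show "emeasure (step_law N p \<alpha>) A = emeasure ?D A"
    using A by (simp add: emeasure_step_law)
qed (simp add: sets_step_law)

lemma char_step_law:
  assumes "\<And>i. i \<le> N \<Longrightarrow> 0 \<le> p i"
  shows "char (step_law N p \<alpha>) s = of_real (p 0 + (\<Sum>i=1..N. p i * cos (\<alpha> i * s)))"
proof -
  let ?P = "point_measure ({0..N} \<times> (UNIV :: bool set)) (\<lambda>(i, b). p i / 2)"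
  let ?e = "\<lambda>i b. (p i / 2) *\<^sub>R iexp (s * atom \<alpha> (i, b))"
  have "step_law N p \<alpha> = distr ?P borel (atom \<alpha>)"
    using assms by (rule step_law_eq_distr)
  then have "char (step_law N p \<alpha>) s = (CLINT x|distr ?P borel (atom \<alpha>). iexp (s * x))"
    by (simp only: char_def)
  also have "\<dots> = (CLINT x|?P. iexp (s * atom \<alpha> x))"
    by (rule integral_distr) (auto simp: measurable_point_measure_eq1)
  also have "\<dots> = (\<Sum>x\<in>{0..N} \<times> UNIV. (case x of (i, b) \<Rightarrow> p i / 2) *\<^sub>R iexp (s * atom \<alpha> x))"
    using assms by (intro lebesgue_integral_point_measure_finite) auto
  also have "\<dots> = (\<Sum>i\<in>{0..N}. \<Sum>b\<in>UNIV. ?e i b)"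
    by (subst sum.cartesian_product) (rule sum.cong, auto)
  also have "\<dots> = (\<Sum>i\<in>{0..N}. ?e i True + ?e i False)"
    by (simp only: sum_UNIV_bool)
  also have "\<dots> = (?e 0 True + ?e 0 False) + (\<Sum>i=1..N. ?e i True + ?e i False)"
    by (simp add: sum.atLeast_Suc_atMost)
  also have "?e 0 True + ?e 0 False = of_real (p 0)"
    by (simp add: atom_def scaleR_conv_of_real)
  also have "(\<Sum>i=1..N. ?e i True + ?e i False) = (\<Sum>i=1..N. of_real (p i * cos (\<alpha> i * s)))"
    by (rule sum.cong) (auto simp: atom_def scaleR_conv_of_real cos_exp_eq mult_ac ring_distribs
          simp flip: cos_of_real)
  finally show ?thesis by simp
qed

theorem theorem4p5:
  fixes M :: "'a measure" and u :: "nat \<Rightarrow> 'a \<Rightarrow> real"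
    and N :: nat and \<alpha> p :: "nat \<Rightarrow> real" and \<sigma> \<gamma> :: real and \<delta> :: "nat \<Rightarrow> real"
  assumes "N \<ge> 1"
    and "rationally_independent {1..N} \<alpha>"
    and "p 0 > 0" and "\<And>i. i \<in> {1..N} \<Longrightarrow> 0 < p i \<and> p i < 1"
    and "(\<Sum>i=0..N. p i) = 1"
    and "prob_space M"
    and "prob_space.indep_vars M (\<lambda>_. borel) u {1..}"
    and "\<And>j. j \<ge> 1 \<Longrightarrow> distr M borel (u j) = step_law N p \<alpha>"
    and "\<sigma> > 0" and "\<sigma>\<^sup>2 = (\<Sum>i=1..N. p i * (\<alpha> i)\<^sup>2)"
    and "0 < \<gamma>" and "\<gamma> < 1 / 2"
    and "\<And>n. n \<ge> 1 \<Longrightarrow> \<delta> n > 0"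
    and "\<delta> \<longlonglongrightarrow> 0"
    and "\<And>n. n \<ge> 1 \<Longrightarrow> \<delta> n \<ge> real n powr (- (1 / 2 - \<gamma>))"
  shows "(\<lambda>n. measure M {\<omega> \<in> space M. walk u (2 * n) \<omega> \<in> {- inverse (\<delta> n)<..<inverse (\<delta> n)}})
           \<sim>[at_top] (\<lambda>n. 2 * inverse (\<delta> n) * (1 / (sqrt (2 * pi * (2 * real n)) * \<sigma>)))"
proof -
  define L where "L n = inverse (\<delta> n)" for n
  define \<phi> where "\<phi> s = p 0 + (\<Sum>i=1..N. p i * cos (\<alpha> i * s))" for s
  define C where "C = (\<Sum>i=1..N. p i * \<alpha> i ^ 4 / 24)"
  note \<sigma>2 = assms(10)
  have p_nonneg: "0 \<le> p i" if "i \<le> N" for i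
    using assms(3) assms(4)[of i] that by (cases "i = 0") auto
  have p_sum: "p 0 + (\<Sum>i=1..N. p i) = 1"
    using assms(5) by (simp add: sum.atLeast_Suc_atMost)
  \<comment> \<open>The bounds on the cosine, averaged over the atoms, give the expansion of \<open>\<phi>\<close> at 0 with variance \<open>\<sigma>\<^sup>2\<close>.\<close>
  have lower: "1 - \<sigma>\<^sup>2 * s\<^sup>2 / 2 \<le> \<phi> s" for s
  proof -
    have "(\<Sum>i=1..N. p i * (1 - (\<alpha> i * s)\<^sup>2 / 2)) \<le> (\<Sum>i=1..N. p i * cos (\<alpha> i * s))"
      by (intro sum_mono mult_left_mono cos_quadratic_bound p_nonneg) auto
    moreover have "(\<Sum>i=1..N. p i * (1 - (\<alpha> i * s)\<^sup>2 / 2)) = (\<Sum>i=1..N. p i) - \<sigma>\<^sup>2 * s\<^sup>2 / 2"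
      unfolding \<sigma>2 sum_distrib_right sum_divide_distrib sum_subtractf[symmetric]
      by (rule sum.cong) (simp_all add: power_mult_distrib algebra_simps)
    ultimately show ?thesis
      using p_sum by (simp add: \<phi>_def)
  qed
  have upper: "\<phi> s \<le> 1 - \<sigma>\<^sup>2 * s\<^sup>2 / 2 + C * s ^ 4" for s
  proof -
    have "(\<Sum>i=1..N. p i * cos (\<alpha> i * s)) \<le> (\<Sum>i=1..N. p i * (1 - (\<alpha> i * s)\<^sup>2 / 2 + (\<alpha> i * s) ^ 4 / 24))"
      by (intro sum_mono mult_left_mono cos_quartic_bound p_nonneg) auto
    moreover have "(\<Sum>i=1..N. p i * (1 - (\<alpha> i * s)\<^sup>2 / 2 + (\<alpha> i * s) ^ 4 / 24))
        = (\<Sum>i=1..N. p i) - \<sigma>\<^sup>2 * s\<^sup>2 / 2 + C * s ^ 4"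
      unfolding \<sigma>2 C_def sum_distrib_right sum_divide_distrib sum_subtractf[symmetric] sum.distrib[symmetric]
      by (rule sum.cong) (simp_all add: power_mult_distrib algebra_simps)
    ultimately show ?thesis
      using p_sum by (simp add: \<phi>_def)
  qed
  have C: "C \<ge> 0"
    unfolding C_def by (intro sum_nonneg) (simp add: p_nonneg)
  have char_u: "char (distr M borel (u j)) s = of_real (\<phi> s)" if "j \<ge> 1" for j s
    unfolding assms(8)[OF that] \<phi>_def by (rule char_step_law) (rule p_nonneg)
  \<comment> \<open>The sequences are shifted by one, since nothing is known about \<open>\<delta> 0\<close>.\<close>
  have \<delta>: "\<delta> (Suc n) > 0" for n
    using assms(13) by simp
  have \<delta>0: "(\<lambda>n. \<delta> (Suc n)) \<longlonglongrightarrow> 0"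
    using assms(14) by (rule LIMSEQ_Suc)
  have L: "L (Suc n) > 0" for n
    using \<delta> by (simp add: L_def)
  have L_top: "filterlim (\<lambda>n. L (Suc n)) at_top sequentially"
    unfolding L_def
    by (rule filterlim_inverse_at_top[OF \<delta>0]) (simp add: \<delta>)
  have L_small: "(\<lambda>n. L (Suc n) / sqrt (2 * Suc n)) \<longlonglongrightarrow> 0"
  proof (rule tendsto_sandwich[OF _ _ tendsto_const])
    show "\<forall>\<^sub>F n in sequentially. 0 \<le> L (Suc n) / sqrt (2 * Suc n)"
      using L by (intro always_eventually allI) (simp add: less_imp_le)
    have "L (Suc n) / sqrt (2 * Suc n) \<le> real (Suc n) powr (- \<gamma>)" for n
    proof -
      let ?x = "real (Suc n)"
      have "L (Suc n) \<le> inverse (?x powr (- (1 / 2 - \<gamma>)))"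
        unfolding L_def by (rule le_imp_inverse_le[OF assms(15)]) auto
      also have "\<dots> = ?x powr (1 / 2) * ?x powr (- \<gamma>)"
        by (simp only: powr_minus[symmetric] powr_add[symmetric]) simp
      also have "?x powr (1 / 2) = sqrt ?x"
        by (rule powr_half_sqrt) simp
      also have "sqrt ?x * ?x powr (- \<gamma>) \<le> sqrt (2 * ?x) * ?x powr (- \<gamma>)"
        by (intro mult_right_mono) auto
      finally show ?thesis
        by (simp add: divide_le_eq mult.commute)
    qed
    then show "\<forall>\<^sub>F n in sequentially. L (Suc n) / sqrt (2 * Suc n) \<le> real (Suc n) powr (- \<gamma>)"
      by simp
    show "(\<lambda>n. real (Suc n) powr (- \<gamma>)) \<longlonglongrightarrow> 0"
      using assms(11)
      by (intro tendsto_neg_powr filterlim_compose[OF filterlim_real_sequentially filterlim_Suc]) auto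
  qed
  define P where "P n = measure M {\<omega> \<in> space M. walk u (2 * n) \<omega> \<in> {- L n<..<L n}}" for n
  have m_top: "filterlim (\<lambda>n. 2 * Suc n) at_top sequentially"
    by (rule filterlim_subseq) (simp add: strict_mono_def)
  have "(\<lambda>n. P (Suc n) * sqrt (2 * Suc n) / L (Suc n)) \<longlonglongrightarrow> 2 / (sqrt (2 * pi) * \<sigma>)"
    unfolding P_def
    using walk_small_ball_limit[OF assms(6,7) char_u assms(9) C lower upper m_top _ L_top L] L_small
    by simp
  from tendsto_mult[OF this tendsto_const[of "sqrt (2 * pi) * \<sigma> / 2"]]
  have "(\<lambda>n. P (Suc n) * sqrt (2 * Suc n) / L (Suc n) * (sqrt (2 * pi) * \<sigma> / 2)) \<longlonglongrightarrow> 1"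
    using assms(9) by simp
  moreover have "P (Suc n) / (2 * L (Suc n) * (1 / (sqrt (2 * pi * (2 * real (Suc n))) * \<sigma>)))
      = P (Suc n) * sqrt (2 * Suc n) / L (Suc n) * (sqrt (2 * pi) * \<sigma> / 2)" for n
  proof -
    have "sqrt (2 * pi * (2 * real (Suc n))) = sqrt (2 * pi) * sqrt (2 * Suc n)"
      by (simp only: real_sqrt_mult of_nat_mult of_nat_numeral)
    then show ?thesis
      by (simp only:) (simp add: mult_ac)
  qed
  ultimately have "(\<lambda>n. P (Suc n) / (2 * L (Suc n) * (1 / (sqrt (2 * pi * (2 * real (Suc n))) * \<sigma>)))) \<longlonglongrightarrow> 1"
    by (simp only:)
  then have "(\<lambda>n. P n / (2 * L n * (1 / (sqrt (2 * pi * (2 * real n)) * \<sigma>)))) \<longlonglongrightarrow> 1"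
    by (rule LIMSEQ_imp_Suc)
  then show ?thesis
    unfolding P_def L_def by (rule asymp_equivI')
qed

end
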